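(* Let $F:\mathbb{R}^n\to\mathbb{R}^n$ admit continuous derivatives for all $x\in\mathbb{R}^n$ and let $\{x^k\}$ be generated by Algorithm SRM (described in the context). Suppose that $\sum_{k=0}^\infty \eta_k=\eta<\infty$ and that the level set $\{x\in\mathbb{R}^n \mid f(x)\le f(x^0)+\eta\}$ is bounded. Assume that at least one of the following possibilities holds: 1. Algorithm SRM stops at Step 1 for some $k\in\mathbb{N}$. 2. There exists an infinite set of indices $K_1\subset\mathbb{N}$ such that $\lim_{k\in K_1}\|F(x^k)\|=0$. 3. There exist $\omega>0$ and an infinite set of indices $K_2\subset\mathbb{N}$ such that $\lim_{k\in K_2}\alpha_k=0$ and $$|\langle v^k, J(x^k)^TF(x^k)\rangle|\ge \omega\,\|v^k\|\,\|J(x^k)^TF(x^k)\|\quad\text{for all }k\in K_2.$$ Then, for any given $\varepsilon>0$, there exists $k\in\mathbb{N}$ such that $\|J(x^k)^TF(x^k)\|\le\varepsilon$. Moreover, if the algorithm does not stop at Step 1 with $\|F(x^k)\|=0$, there exists a limit point $x_*$ of the sequence generated by the algorithm such that $\|J(x_* )^TF(x_* )\|=0$.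
   Context: Notation: $\|\cdot\|$ is the Euclidean norm, $\mathbb{N}=\{0,1,2,\dots\}$, $J(x)$ is the Jacobian matrix of $F$ at $x$, and $f(x)=\frac12\|F(x)\|^2$. For an infinite set $K=\{k_1<k_2<\cdots\}\subset\mathbb{N}$, $\lim_{k\in K}z_k$ means $\lim_{j\to\infty}z_{k_j}$. Algorithm SRM (for $F:\mathbb{R}^n\to\mathbb{R}^n$). Parameters: $\gamma\in(0,1)$, $0<\sigma_{\min}<\sigma_{\max}<\infty$, $0<\tau_{\min}<\tau_{\max}<1$, a positive integer $M$, a sequence $\{\eta_k\}$ with $\eta_k>0$ for all $k\in\mathbb{N}$ and $\lim_{k\to\infty}\eta_k=0$, and $x^0\in\mathbb{R}^n$. Set $k\leftarrow 0$. Step 1. If $F(x^k)=0$, terminate. Step 2. Choose (arbitrarily) $\sigma_k$ with $|\sigma_k|\in[\sigma_{\min},\sigma_{\max}]$ and $v^k\in\mathbb{R}^n$ with $\|v^k\|=\|F(x^k)\|$. Compute $\bar f_k=\max\{f(x^k),\dots,f(x^{\max\{0,k-M+1\}})\}$. Step 2.1. Set $\alpha_+\leftarrow 1$, $\alpha_-\leftarrow 1$. Step 2.2. Set $d\leftarrow-\sigma_kv^k$, $\alpha\leftarrow\alpha_+$. If $f(x^k+\alpha d)\le\bar f_k+\eta_k-\gamma\alpha^2f(x^k)$ (sufficient decrease condition), define $d^k=d$, $\alpha_k=\alpha$ and go to Step 3. Step 2.3. Set $d\leftarrow\sigma_kv^k$, $\alpha\leftarrow\alpha_-$. If the sufficient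 decrease condition holds, define $d^k=d$, $\alpha_k=\alpha$ and go to Step 3. Step 2.4. Choose $\alpha_+^{\mathrm{new}}\in[\tau_{\min}\alpha_+,\tau_{\max}\alpha_+]$ and $\alpha_-^{\mathrm{new}}\in[\tau_{\min}\alpha_-,\tau_{\max}\alpha_-]$, set $\alpha_+\leftarrow\alpha_+^{\mathrm{new}}$, $\alpha_-\leftarrow\alpha_-^{\mathrm{new}}$, and go to Step 2.2. Step 3. Compute any $x^{k+1}$ such that $f(x^{k+1})\le f(x^k+\alpha_kd^k)$, set $k\leftarrow k+1$, and go to Step 1. *)

theory Defs
  imports "HOL-Analysis.Analysis" "HOL-Library.Extended_Nat" "HOL-Library.Infinite_Set"
begin

definition merit :: "(real^'n \<Rightarrow> real^'n) \<Rightarrow> real^'n \<Rightarrow> real"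
  where "merit F y = 1/2 * (norm (F y))\<^sup>2"

definition suff_decrease ::
  "(real^'n \<Rightarrow> real^'n) \<Rightarrow> real \<Rightarrow> real \<Rightarrow> real \<Rightarrow> real^'n \<Rightarrow> real^'n \<Rightarrow> real \<Rightarrow> bool"
  where "suff_decrease F \<gamma> fbar e y d a \<longleftrightarrow>
    merit F (y + a *\<^sub>R d) \<le> fbar + e - \<gamma> * a\<^sup>2 * merit F y"

text \<open>The pairs \<open>(\<alpha>\<^sub>+, \<alpha>\<^sub>-)\<close> that can be current at Step 2.2 of the line search along \<open>\<plusminus>p\<close>
  (with \<open>p = \<sigma>\<^sub>k v\<^sup>k\<close>), where \<open>acc d a\<close> is the sufficient decrease condition. A pair is replaced
  only after both of its trial points have been rejected.\<close>

inductive srm_trial ::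
  "(real^'n \<Rightarrow> real \<Rightarrow> bool) \<Rightarrow> real \<Rightarrow> real \<Rightarrow> real^'n \<Rightarrow> real \<Rightarrow> real \<Rightarrow> bool"
  for acc \<tau>min \<tau>max p
  where
    start: "srm_trial acc \<tau>min \<tau>max p 1 1"
  | backtrack: "srm_trial acc \<tau>min \<tau>max p ap' am'"
      if "srm_trial acc \<tau>min \<tau>max p ap am"
        and "\<not> acc (- p) ap" and "\<not> acc p am"
        and "ap' \<in> {\<tau>min * ap .. \<tau>max * ap}" and "am' \<in> {\<tau>min * am .. \<tau>max * am}"

definition srm_line_search ::
  "(real^'n \<Rightarrow> real \<Rightarrow> bool) \<Rightarrow> real \<Rightarrow> real \<Rightarrow> real^'n \<Rightarrow> real^'n \<Rightarrow> real \<Rightarrow> bool"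
  where "srm_line_search acc \<tau>min \<tau>max p d a \<longleftrightarrow>
    (\<exists>ap am. srm_trial acc \<tau>min \<tau>max p ap am \<and>
      (acc (- p) ap \<and> d = - p \<and> a = ap \<or>
       \<not> acc (- p) ap \<and> acc p am \<and> d = p \<and> a = am))"

definition srm_params ::
  "real \<Rightarrow> real \<Rightarrow> real \<Rightarrow> real \<Rightarrow> real \<Rightarrow> nat \<Rightarrow> (nat \<Rightarrow> real) \<Rightarrow> bool"
  where "srm_params \<gamma> \<sigma>min \<sigma>max \<tau>min \<tau>max M \<eta> \<longleftrightarrow>
    0 < \<gamma> \<and> \<gamma> < 1 \<and> 0 < \<sigma>min \<and> \<sigma>min < \<sigma>max \<and>
    0 < \<tau>min \<and> \<tau>min < \<tau>max \<and> \<tau>max < 1 \<and> 0 < M \<and>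
    (\<forall>k. 0 < \<eta> k) \<and> \<eta> \<longlonglongrightarrow> 0"

text \<open>As \<open>M \<ge> 1\<close>, truncated subtraction makes \<open>k + 1 - M\<close> the index \<open>max {0, k - M + 1}\<close>.\<close>

definition srm_fbar :: "(real^'n \<Rightarrow> real^'n) \<Rightarrow> nat \<Rightarrow> (nat \<Rightarrow> real^'n) \<Rightarrow> nat \<Rightarrow> real"
  where "srm_fbar F M x k = Max ((\<lambda>j. merit F (x j)) ` {k + 1 - M .. k})"

text \<open>A complete execution of Algorithm SRM. \<open>N\<close> is the index at which it stops at Step 1, and
  \<open>\<infinity>\<close> if it never stops there. Iterates \<open>x k\<close> exist for \<open>k \<le> N\<close>, while \<open>\<sigma> k\<close>, \<open>v k\<close>, \<open>d k\<close>,
  \<open>\<alpha> k\<close> exist for \<open>k < N\<close>; the values of the functions at other indices are meaningless.\<close>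

definition srm_run ::
  "(real^'n \<Rightarrow> real^'n) \<Rightarrow> real \<Rightarrow> real \<Rightarrow> real \<Rightarrow> real \<Rightarrow> real \<Rightarrow> nat \<Rightarrow> (nat \<Rightarrow> real) \<Rightarrow> enat \<Rightarrow>
   (nat \<Rightarrow> real^'n) \<Rightarrow> (nat \<Rightarrow> real) \<Rightarrow> (nat \<Rightarrow> real^'n) \<Rightarrow> (nat \<Rightarrow> real^'n) \<Rightarrow> (nat \<Rightarrow> real) \<Rightarrow> bool"
  where "srm_run F \<gamma> \<sigma>min \<sigma>max \<tau>min \<tau>max M \<eta> N x \<sigma> v d \<alpha> \<longleftrightarrow>
    (\<forall>m. N = enat m \<longrightarrow> F (x m) = 0) \<and>
    (\<forall>k. enat k < N \<longrightarrow>
      F (x k) \<noteq> 0 \<and>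
      \<bar>\<sigma> k\<bar> \<in> {\<sigma>min .. \<sigma>max} \<and>
      norm (v k) = norm (F (x k)) \<and>
      srm_line_search (suff_decrease F \<gamma> (srm_fbar F M x k) (\<eta> k) (x k))
        \<tau>min \<tau>max (\<sigma> k *\<^sub>R v k) (d k) (\<alpha> k) \<and>
      merit F (x (Suc k)) \<le> merit F (x k + \<alpha> k *\<^sub>R d k))"

definition JTF :: "(real^'n \<Rightarrow> real^'n) \<Rightarrow> real^'n \<Rightarrow> real^'n"
  where "JTF F y = transpose (jacobian F (at y)) *v F y"

definition seq_limit_point :: "(nat \<Rightarrow> 'a::topological_space) \<Rightarrow> 'a \<Rightarrow> bool"
  where "seq_limit_point x l \<longleftrightarrow> (\<exists>r. strict_mono r \<and> (x \<circ> r) \<longlonglongrightarrow> l)"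

end

theory Submission
  imports Defs
begin

text \<open>The merit values stay below \<open>merit F (x 0) + \<eta>sum\<close>, so the iterates lie in a bounded set and
  subsequences have limit points. If \<open>\<alpha> k\<close> tends to 0 along \<open>K2\<close>, the number of backtracking rounds
  tends to infinity, so the last rejected steps in both directions \<open>\<plusminus>\<sigma> k *\<^sub>R v k\<close> tend to 0. In the
  limit, the rejections say that the gradient \<open>JTF F\<close> of the merit function has nonnegative inner
  product with both \<open>p\<close> and \<open>- p\<close>, where \<open>p\<close> is a limit of the directions. The angle condition then
  forces \<open>p = 0\<close> or a vanishing gradient, and \<open>p = 0\<close> means \<open>F = 0\<close> at the limit point.\<close>

section \<open>Limits of directional derivatives and the gradient of the merit function\<close>

text \<open>By the mean value theorem, the derivative along \<open>q j\<close> is at least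
  \<open>- c j\<close> somewhere on each segment. The segments shrink to \<open>y'\<close>, so
  continuity of \<open>g\<close> carries the bound to the limit. The slack \<open>c j\<close>
  absorbs the quadratic term of the decrease condition after division by the step.\<close>

lemma directional_derivative_limit_nonneg:
  fixes f :: "'a::real_inner \<Rightarrow> real" and g :: "'a \<Rightarrow> 'a" and y q :: "nat \<Rightarrow> 'a"
  assumes deriv: "\<And>z. (f has_derivative (\<lambda>h. g z \<bullet> h)) (at z)"
    and cont: "continuous_on UNIV g"
    and lims: "y \<longlonglongrightarrow> y'" "q \<longlonglongrightarrow> q'" "a \<longlonglongrightarrow> 0" "c \<longlonglongrightarrow> 0"
    and pos: "\<And>j. 0 < a j"
    and incr: "\<And>j. f (y j + a j *\<^sub>R q j) \<ge> f (y j) - a j * c j"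
  shows "g y' \<bullet> q' \<ge> 0"
proof -
  have "\<exists>t. 0 < t \<and> t < a j \<and> - c j \<le> g (y j + t *\<^sub>R q j) \<bullet> q j" for j
  proof -
    have der: "((\<lambda>t. f (y j + t *\<^sub>R q j)) has_real_derivative g (y j + t *\<^sub>R q j) \<bullet> q j) (at t)" for t
      unfolding has_field_derivative_def
      by (rule has_derivative_eq_rhs,
          rule has_derivative_compose[OF _ deriv, where f = "\<lambda>t. y j + t *\<^sub>R q j"])
        (auto intro!: derivative_eq_intros simp: mult.commute)
    obtain t where t: "0 < t" "t < a j"
        "f (y j + a j *\<^sub>R q j) - f (y j + 0 *\<^sub>R q j) = (a j - 0) * (g (y j + t *\<^sub>R q j) \<bullet> q j)"
      using MVT2[OF pos[of j] der] by blast
    then have "a j * (- c j) \<le> a j * (g (y j + t *\<^sub>R q j) \<bullet> q j)"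
      using incr[of j] by simp
    then have "- c j \<le> g (y j + t *\<^sub>R q j) \<bullet> q j"
      using pos[of j] mult_le_cancel_left_pos by blast
    with t show ?thesis by blast
  qed
  then obtain t where t: "\<And>j. 0 < t j" "\<And>j. t j < a j"
      "\<And>j. - c j \<le> g (y j + t j *\<^sub>R q j) \<bullet> q j"
    by metis
  have "t \<longlonglongrightarrow> 0"
    by (rule tendsto_sandwich[OF _ _ tendsto_const lims(3)]) (use t(1,2) in \<open>auto simp: less_imp_le\<close>)
  from tendsto_add[OF lims(1) tendsto_scaleR[OF this lims(2)]]
  have "(\<lambda>j. y j + t j *\<^sub>R q j) \<longlonglongrightarrow> y'" by simp
  then have "(\<lambda>j. g (y j + t j *\<^sub>R q j)) \<longlonglongrightarrow> g y'"
    using cont continuous_on_tendsto_compose[OF cont] by simp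
  then have "(\<lambda>j. g (y j + t j *\<^sub>R q j) \<bullet> q j) \<longlonglongrightarrow> g y' \<bullet> q'"
    by (intro tendsto_inner lims)
  moreover have "(\<lambda>j. - c j) \<longlonglongrightarrow> 0"
    using tendsto_minus[OF lims(4)] by simp
  ultimately show ?thesis
    using LIMSEQ_le t(3) by blast
qed

lemma merit_has_derivative:
  fixes F :: "real^'n \<Rightarrow> real^'n"
  assumes "F differentiable (at y)"
  shows "(merit F has_derivative (\<lambda>h. JTF F y \<bullet> h)) (at y)"
proof -
  have F: "(F has_derivative (\<lambda>h. jacobian F (at y) *v h)) (at y)"
    using assms jacobian_works by blast
  \<comment> \<open>Writing the squared norm as an inner product avoids differentiating
    \<open>norm\<close>, which fails at zeros of \<open>F\<close>.\<close>
  have "((\<lambda>y. 1/2 * (F y \<bullet> F y)) has_derivative (\<lambda>h. JTF F y \<bullet> h)) (at y)"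
    by (rule has_derivative_eq_rhs,
        rule has_derivative_mult_right[OF has_derivative_inner[OF F F]])
      (simp add: JTF_def transpose_matrix_vector dot_lmul_matrix inner_commute[of "_ *v _"])
  moreover have "merit F = (\<lambda>y. 1/2 * (F y \<bullet> F y))"
    by (simp add: merit_def dot_square_norm fun_eq_iff)
  ultimately show ?thesis by simp
qed

lemma continuous_on_JTF:
  fixes F :: "real^'n \<Rightarrow> real^'n"
  assumes "\<forall>y. F differentiable (at y)" and "continuous_on UNIV (\<lambda>y. jacobian F (at y))"
  shows "continuous_on UNIV (JTF F)"
proof -
  have F: "continuous_on UNIV F"
    using assms(1) by (simp add: continuous_on_eq_continuous_at differentiable_imp_continuous_within)
  show ?thesis
    unfolding JTF_def matrix_vector_mult_def transpose_def
    by (rule continuous_on_vec_lambda) (auto intro!: continuous_intros F assms(2))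
qed

lemma JTF_eq_0: "F y = 0 \<Longrightarrow> JTF F y = 0"
  by (simp add: JTF_def)

section \<open>Backtracking rounds and rejected steps\<close>

text \<open>Both steps are reduced in every round, so a single exponent \<open>j\<close> controls
  both directions: a small accepted step in one direction forces small rejected steps in both. The
  pair \<open>bp\<close>, \<open>bm\<close> is the one current just before \<open>ap\<close>,
  \<open>am\<close>.\<close>

lemma srm_trial_bounds:
  assumes "srm_trial acc \<tau>min \<tau>max p ap am" and "0 < \<tau>min" "\<tau>min < \<tau>max"
  shows "ap = 1 \<and> am = 1 \<or>
    (\<exists>j bp bm. \<not> acc (- p) bp \<and> \<not> acc p bm \<and>
      {ap, am} \<subseteq> {\<tau>min ^ Suc j .. \<tau>max ^ Suc j} \<and> {bp, bm} \<subseteq> {\<tau>min ^ j .. \<tau>max ^ j})"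
  using assms(1)
proof induction
  case start
  show ?case by simp
next
  case (backtrack ap am ap' am')
  have scale: "b \<in> {\<tau>min ^ Suc j .. \<tau>max ^ Suc j}"
    if "a \<in> {\<tau>min ^ j .. \<tau>max ^ j}" "b \<in> {\<tau>min * a .. \<tau>max * a}" for a b j
  proof -
    have "\<tau>min ^ Suc j \<le> \<tau>min * a" "\<tau>max * a \<le> \<tau>max ^ Suc j"
      using that(1) assms(2,3) by simp_all
    with that(2) show ?thesis by auto
  qed
  \<comment> \<open>The initial pair \<open>(1, 1)\<close> fits the same range with exponent
    0.\<close>
  from backtrack.IH obtain j where "{ap, am} \<subseteq> {\<tau>min ^ j .. \<tau>max ^ j}"
  proof
    assume "ap = 1 \<and> am = 1"
    then show ?thesis using that[of 0] by simp
  qed (use that in blast)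
  \<comment> \<open>The pair \<open>ap\<close>, \<open>am\<close>, rejected in this round, supplies
    \<open>bp\<close> and \<open>bm\<close>.\<close>
  with backtrack.hyps scale show ?case by (meson empty_subsetI insert_subset)
qed

text \<open>The assumption \<open>a < 1\<close> excludes acceptance at the initial pair, so at least
  one round of rejections took place.\<close>

lemma srm_line_search_rejected:
  assumes "srm_line_search acc \<tau>min \<tau>max p d a" and "0 < \<tau>min" "\<tau>min < \<tau>max" and "a < 1"
  obtains j bp bm where "\<not> acc (- p) bp" "\<not> acc p bm" "\<tau>min ^ Suc j \<le> a"
    "bp \<in> {\<tau>min ^ j .. \<tau>max ^ j}" "bm \<in> {\<tau>min ^ j .. \<tau>max ^ j}"
proof -
  obtain ap am where tr: "srm_trial acc \<tau>min \<tau>max p ap am" and a: "a = ap \<or> a = am"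
    using assms(1) unfolding srm_line_search_def by blast
  from srm_trial_bounds[OF tr assms(2,3)] a assms(4) obtain j bp bm where
    "\<not> acc (- p) bp" "\<not> acc p bm" "{ap, am} \<subseteq> {\<tau>min ^ Suc j .. \<tau>max ^ Suc j}"
    "{bp, bm} \<subseteq> {\<tau>min ^ j .. \<tau>max ^ j}"
    by fastforce
  with a show thesis by (intro that[of bp bm j]) auto
qed

text \<open>Powers of \<open>t\<close> decrease, so \<open>a i < t ^ m\<close> rules out exponents
  below \<open>m\<close>. With \<open>t = \<tau>min\<close>, vanishing accepted steps force the
  number of rounds to infinity.\<close>

lemma exponent_at_top:
  fixes t :: real
  assumes "0 < t" "t < 1" and "a \<longlonglongrightarrow> 0" and le: "\<And>i. t ^ Suc (j i) \<le> a i"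
  shows "filterlim j at_top sequentially"
  unfolding filterlim_at_top
proof
  fix m :: nat
  have "eventually (\<lambda>i. a i < t ^ m) sequentially"
    using assms by (intro order_tendstoD) auto
  then show "eventually (\<lambda>i. m \<le> j i) sequentially"
  proof eventually_elim
    case (elim i)
    then have "t ^ Suc (j i) < t ^ m" using le[of i] by simp
    then have "m < Suc (j i)"
      using assms(1,2) power_strict_decreasing_iff by blast
    then show ?case by simp
  qed
qed

section \<open>Uniform bound on the merit values\<close>

lemma merit_le_srm_fbar:
  assumes "0 < M"
  shows "merit F (x k) \<le> srm_fbar F M x k"
  unfolding srm_fbar_def using assms by (intro Max_ge) auto

lemma merit_iterates_le:
  assumes run: "srm_run F \<gamma> \<sigma>min \<sigma>max \<tau>min \<tau>max M \<eta> \<infinity> x \<sigma> v d \<alpha>"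
    and par: "srm_params \<gamma> \<sigma>min \<sigma>max \<tau>min \<tau>max M \<eta>" and "\<eta> sums \<eta>sum"
  shows "merit F (x k) \<le> merit F (x 0) + \<eta>sum"
proof -
  have \<eta>: "0 \<le> \<eta> k" for k
    using par by (simp add: srm_params_def less_imp_le)
  \<comment> \<open>Partial sums give a bound that can be propagated; the induction is strong
    because \<open>srm_fbar\<close> looks back over several iterates.\<close>
  have "merit F (x k) \<le> merit F (x 0) + sum \<eta> {..<k}"
  proof (induction k rule: less_induct)
    case (less k)
    show ?case
    proof (cases k)
      case 0
      then show ?thesis by simp
    next
      case (Suc m)
      have ls: "srm_line_search (suff_decrease F \<gamma> (srm_fbar F M x m) (\<eta> m) (x m))
          \<tau>min \<tau>max (\<sigma> m *\<^sub>R v m) (d m) (\<alpha> m)"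
        and step: "merit F (x (Suc m)) \<le> merit F (x m + \<alpha> m *\<^sub>R d m)"
        using run unfolding srm_run_def by auto
      from ls have "suff_decrease F \<gamma> (srm_fbar F M x m) (\<eta> m) (x m) (d m) (\<alpha> m)"
        unfolding srm_line_search_def by auto
      moreover have "0 \<le> \<gamma> * (\<alpha> m)\<^sup>2 * merit F (x m)"
        using par by (simp add: merit_def srm_params_def)
      ultimately have "merit F (x k) \<le> srm_fbar F M x m + \<eta> m"
        using step Suc unfolding suff_decrease_def by simp
      moreover have "srm_fbar F M x m \<le> merit F (x 0) + sum \<eta> {..<m}"
        unfolding srm_fbar_def
      proof (rule Max.boundedI)
        show "(\<lambda>j. merit F (x j)) ` {m + 1 - M..m} \<noteq> {}"
          using par by (auto simp: srm_params_def)
        fix a assume "a \<in> (\<lambda>j. merit F (x j)) ` {m + 1 - M..m}"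
        then obtain j where j: "j \<le> m" "a = merit F (x j)" by auto
        have "a \<le> merit F (x 0) + sum \<eta> {..<j}" using less.IH[of j] j Suc by simp
        \<comment> \<open>Since \<open>\<eta>\<close> is nonnegative, the bound for the newest index
          of the window covers all older ones.\<close>
        also have "sum \<eta> {..<j} \<le> sum \<eta> {..<m}" using j \<eta> by (intro sum_mono2) auto
        finally show "a \<le> merit F (x 0) + sum \<eta> {..<m}" by simp
      qed simp
      ultimately show ?thesis using Suc by simp
    qed
  qed
  also have "sum \<eta> {..<k} \<le> \<eta>sum"
    using sum_le_suminf[of \<eta> "{..<k}"] assms(3) \<eta> by (simp add: sums_iff)
  finally show ?thesis by simp
qed

section \<open>Stationarity under the angle condition\<close>

text \<open>Compactness is left to the caller: \<open>r\<close> selects indices along which iterates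
  and scaled directions already converge.\<close>

lemma stationary_if_angle_condition:
  fixes F :: "real^'n \<Rightarrow> real^'n"
  assumes diff: "\<forall>y. F differentiable (at y)"
    and cont: "continuous_on UNIV (\<lambda>y. jacobian F (at y))"
    and par: "srm_params \<gamma> \<sigma>min \<sigma>max \<tau>min \<tau>max M \<eta>"
    and run: "srm_run F \<gamma> \<sigma>min \<sigma>max \<tau>min \<tau>max M \<eta> \<infinity> x \<sigma> v d \<alpha>"
    and lims: "(x \<circ> r) \<longlonglongrightarrow> xs" "(\<lambda>i. \<sigma> (r i) *\<^sub>R v (r i)) \<longlonglongrightarrow> p" "(\<lambda>i. \<alpha> (r i)) \<longlonglongrightarrow> 0"
    and "0 < \<omega>"
    and angle: "\<And>i. \<bar>v (r i) \<bullet> JTF F (x (r i))\<bar> \<ge> \<omega> * norm (v (r i)) * norm (JTF F (x (r i)))"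
  shows "JTF F xs = 0"
proof -
  obtain n0 where n0: "\<And>i. i \<ge> n0 \<Longrightarrow> \<alpha> (r i) < 1"
    using order_tendstoD(2)[OF lims(3), of 1] by (auto simp: eventually_sequentially)
  \<comment> \<open>After this shift every accepted step is below 1, so every line search has
    rejected a pair.\<close>
  define s where "s i = r (i + n0)" for i
  define q where "q i = \<sigma> (s i) *\<^sub>R v (s i)" for i
  have xl: "(\<lambda>i. x (s i)) \<longlonglongrightarrow> xs" and ql: "q \<longlonglongrightarrow> p" and al: "(\<lambda>i. \<alpha> (s i)) \<longlonglongrightarrow> 0"
    using LIMSEQ_ignore_initial_segment[OF lims(1), of n0]
      LIMSEQ_ignore_initial_segment[OF lims(2), of n0]
      LIMSEQ_ignore_initial_segment[OF lims(3), of n0]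
    by (simp_all add: s_def q_def[abs_def])
  have \<tau>: "0 < \<tau>min" "\<tau>min < \<tau>max" "\<tau>min < 1" "\<tau>max < 1" and M: "0 < M"
    and \<eta>: "\<And>k. 0 < \<eta> k" and \<sigma>min: "0 < \<sigma>min"
    using par by (auto simp: srm_params_def)
  let ?acc = "\<lambda>i. suff_decrease F \<gamma> (srm_fbar F M x (s i)) (\<eta> (s i)) (x (s i))"
  have "\<exists>j bp bm. \<not> ?acc i (- q i) bp \<and> \<not> ?acc i (q i) bm \<and> \<tau>min ^ Suc j \<le> \<alpha> (s i) \<and>
      bp \<in> {\<tau>min ^ j .. \<tau>max ^ j} \<and> bm \<in> {\<tau>min ^ j .. \<tau>max ^ j}" for i
  proof -
    have "srm_line_search (?acc i) \<tau>min \<tau>max (q i) (d (s i)) (\<alpha> (s i))"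
      using run unfolding srm_run_def q_def by simp
    moreover have "\<alpha> (s i) < 1" using n0 by (simp add: s_def)
    ultimately show ?thesis
      using \<tau> by (blast elim: srm_line_search_rejected)
  qed
  then obtain j bp bm where rej: "\<And>i. \<not> ?acc i (- q i) (bp i)" "\<And>i. \<not> ?acc i (q i) (bm i)"
    and j: "\<And>i. \<tau>min ^ Suc (j i) \<le> \<alpha> (s i)"
    and b: "\<And>i. bp i \<in> {\<tau>min ^ j i .. \<tau>max ^ j i}" "\<And>i. bm i \<in> {\<tau>min ^ j i .. \<tau>max ^ j i}"
    by metis
  have "filterlim j at_top sequentially"
    using exponent_at_top[OF \<tau>(1,3) al j] .
  \<comment> \<open>This upper bound squeezes the rejected steps \<open>bp\<close> and
    \<open>bm\<close> to 0.\<close>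
  then have \<tau>l: "(\<lambda>i. \<tau>max ^ j i) \<longlonglongrightarrow> 0"
    using filterlim_compose[OF LIMSEQ_power_zero[of \<tau>max]] \<tau> by simp
  have F: "continuous_on UNIV F"
    using diff by (simp add: continuous_on_eq_continuous_at differentiable_imp_continuous_within)
  have Fl: "(\<lambda>i. F (x (s i))) \<longlonglongrightarrow> F xs"
    using continuous_on_tendsto_compose[OF F xl] by simp
  then have fl: "(\<lambda>i. merit F (x (s i))) \<longlonglongrightarrow> merit F xs"
    unfolding merit_def by (intro tendsto_intros)
  \<comment> \<open>The direction \<open>u\<close> is kept general so that it can be both
    \<open>q\<close> and \<open>- q\<close>.\<close>
  have nonneg: "JTF F xs \<bullet> q' \<ge> 0"
    if "u \<longlonglongrightarrow> q'" and bb: "\<And>i. b i \<in> {\<tau>min ^ j i .. \<tau>max ^ j i}"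
      and nacc: "\<And>i. \<not> ?acc i (u i) (b i)" for u b q'
  proof -
    have pos: "0 < b i" for i
      using bb[of i] \<tau>(1) by (meson atLeastAtMost_iff less_le_trans zero_less_power)
    have bl: "b \<longlonglongrightarrow> 0"
      by (rule tendsto_sandwich[OF _ _ tendsto_const \<tau>l]) (use bb pos in \<open>auto simp: less_imp_le\<close>)
    have "(\<lambda>i. \<gamma> * b i * merit F (x (s i))) \<longlonglongrightarrow> \<gamma> * 0 * merit F xs"
      by (intro tendsto_intros bl fl)
    then have cl: "(\<lambda>i. \<gamma> * b i * merit F (x (s i))) \<longlonglongrightarrow> 0" by simp
    show ?thesis
    proof (rule directional_derivative_limit_nonneg[OF merit_has_derivative
          continuous_on_JTF[OF diff cont] xl that(1) bl cl pos])
      fix i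
      \<comment> \<open>Rejection bounds the trial value below by \<open>srm_fbar\<close> plus a
        positive \<open>\<eta>\<close> minus the quadratic term; \<open>srm_fbar\<close> dominates
        the current merit value, and one factor \<open>b i\<close> is split off as the step
        length.\<close>
      show "merit F (x (s i)) - b i * (\<gamma> * b i * merit F (x (s i))) \<le> merit F (x (s i) + b i *\<^sub>R u i)"
        using nacc[of i] merit_le_srm_fbar[OF M, of F x "s i"] \<eta>[of "s i"]
        unfolding suff_decrease_def by (simp add: power2_eq_square algebra_simps)
    qed (use diff in simp)
  qed
  have "JTF F xs \<bullet> p = 0"
    using nonneg[OF ql b(2) rej(2)] nonneg[OF tendsto_minus[OF ql] b(1) rej(1)] by simp
  moreover have "\<omega> * norm p * norm (JTF F xs) \<le> \<bar>p \<bullet> JTF F xs\<bar>"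
  proof (rule LIMSEQ_le)
    have gl: "(\<lambda>i. JTF F (x (s i))) \<longlonglongrightarrow> JTF F xs"
      using continuous_on_tendsto_compose[OF continuous_on_JTF[OF diff cont] xl] by simp
    show "(\<lambda>i. \<omega> * norm (q i) * norm (JTF F (x (s i)))) \<longlonglongrightarrow> \<omega> * norm p * norm (JTF F xs)"
      by (intro tendsto_intros ql gl)
    show "(\<lambda>i. \<bar>q i \<bullet> JTF F (x (s i))\<bar>) \<longlonglongrightarrow> \<bar>p \<bullet> JTF F xs\<bar>"
      by (intro tendsto_intros ql gl)
    \<comment> \<open>Both sides of the angle condition scale with \<open>v\<close>, so multiplying
      by \<open>\<bar>\<sigma> (s i)\<bar>\<close> transfers it to \<open>q i\<close>.\<close>
    have "\<omega> * norm (q i) * norm (JTF F (x (s i))) \<le> \<bar>q i \<bullet> JTF F (x (s i))\<bar>" for i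
      using mult_left_mono[OF angle[of "i + n0"], of "\<bar>\<sigma> (s i)\<bar>"]
      by (simp add: q_def s_def abs_mult mult_ac)
    then show "\<exists>N. \<forall>i\<ge>N. \<omega> * norm (q i) * norm (JTF F (x (s i))) \<le> \<bar>q i \<bullet> JTF F (x (s i))\<bar>"
      by blast
  qed
  ultimately have "norm p * norm (JTF F xs) \<le> 0"
    using \<open>0 < \<omega>\<close> by (simp add: inner_commute mult.assoc mult_le_0_iff)
  then have "p = 0 \<or> JTF F xs = 0"
    by (auto simp: mult_le_0_iff)
  \<comment> \<open>This settles the case \<open>p = 0\<close>: then \<open>F xs = 0\<close>, and
    the gradient vanishes with it.\<close>
  moreover have "\<sigma>min * norm (F xs) \<le> norm p"
  proof (rule LIMSEQ_le)
    show "(\<lambda>i. \<sigma>min * norm (F (x (s i)))) \<longlonglongrightarrow> \<sigma>min * norm (F xs)"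
      by (intro tendsto_intros Fl)
    show "(\<lambda>i. norm (q i)) \<longlonglongrightarrow> norm p"
      by (intro tendsto_intros ql)
    have "\<sigma>min * norm (F (x (s i))) \<le> norm (q i)" for i
      using run unfolding srm_run_def q_def by (simp add: mult_right_mono)
    then show "\<exists>N. \<forall>i\<ge>N. \<sigma>min * norm (F (x (s i))) \<le> norm (q i)" by blast
  qed
  ultimately show ?thesis
    using \<sigma>min by (auto simp: mult_le_0_iff intro: JTF_eq_0)
qed

section \<open>Extraction of a stationary limit point\<close>

theorem theorem3p1:
  fixes F :: "real^'n \<Rightarrow> real^'n"
    and x v d :: "nat \<Rightarrow> real^'n"
    and \<sigma> \<alpha> \<eta> :: "nat \<Rightarrow> real"
    and \<gamma> \<sigma>min \<sigma>max \<tau>min \<tau>max \<eta>sum :: real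
    and M :: nat and N :: enat
  assumes "\<forall>y. F differentiable (at y)"
    and "continuous_on UNIV (\<lambda>y. jacobian F (at y))"
    and "srm_params \<gamma> \<sigma>min \<sigma>max \<tau>min \<tau>max M \<eta>"
    and "srm_run F \<gamma> \<sigma>min \<sigma>max \<tau>min \<tau>max M \<eta> N x \<sigma> v d \<alpha>"
    and "\<eta> sums \<eta>sum"
    and "bounded {y. merit F y \<le> merit F (x 0) + \<eta>sum}"
    and "(\<exists>k. N = enat k) \<or>
      (\<exists>K1 \<subseteq> {k. enat k \<le> N}. infinite K1 \<and>
         (\<lambda>j. norm (F (x (enumerate K1 j)))) \<longlonglongrightarrow> 0) \<or>
      (\<exists>\<omega>>0. \<exists>K2 \<subseteq> {k. enat k < N}. infinite K2 \<and>
         (\<lambda>j. \<alpha> (enumerate K2 j)) \<longlonglongrightarrow> 0 \<and>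
         (\<forall>k\<in>K2. \<bar>v k \<bullet> JTF F (x k)\<bar> \<ge> \<omega> * norm (v k) * norm (JTF F (x k))))"
  shows "(\<forall>\<epsilon>>0. \<exists>k. enat k \<le> N \<and> norm (JTF F (x k)) \<le> \<epsilon>) \<and>
    (N = \<infinity> \<longrightarrow> (\<exists>xs. seq_limit_point x xs \<and> norm (JTF F xs) = 0))"
proof (cases N)
  case (enat m)
  then have "F (x m) = 0"
    using assms(4) by (simp add: srm_run_def)
  then have "norm (JTF F (x m)) = 0" by (simp add: JTF_eq_0)
  then show ?thesis using enat by (metis enat.distinct(1) less_imp_le order_refl)
next
  case infinity
  note diff = assms(1) and cont = assms(2) and par = assms(3)
  have run: "srm_run F \<gamma> \<sigma>min \<sigma>max \<tau>min \<tau>max M \<eta> \<infinity> x \<sigma> v d \<alpha>"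
    using assms(4) infinity by simp
  have merit: "merit F (x k) \<le> merit F (x 0) + \<eta>sum" for k
    using merit_iterates_le[OF run par assms(5)] .
  then have bx: "bounded (range x)"
    by (intro bounded_subset[OF assms(6)]) auto
  define p where "p k = \<sigma> k *\<^sub>R v k" for k
  \<comment> \<open>\<open>B\<close> is the bound on \<open>norm (F (x k))\<close> obtained by
    solving the merit bound for the norm.\<close>
  define B where "B = sqrt (2 * (merit F (x 0) + \<eta>sum))"
  have "norm (p k) \<le> \<sigma>max * B" for k
  proof -
    have "norm (F (x k)) \<le> B"
      unfolding B_def using merit[of k] by (intro real_le_rsqrt) (simp add: merit_def[of F "x k"])
    moreover have "\<bar>\<sigma> k\<bar> \<le> \<sigma>max" "norm (v k) = norm (F (x k))"
      using run by (simp_all add: srm_run_def)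
    ultimately show ?thesis
      by (simp add: p_def mult_mono)
  qed
  then have bp: "bounded (range p)"
    by (auto simp: bounded_iff)
  \<comment> \<open>Pairing iterates with directions lets one extraction make both converge along a
    common subsequence.\<close>
  have bounded_pairs: "bounded (range (\<lambda>k. (x k, p k)))"
    by (rule bounded_subset[OF bounded_Times[OF bx bp]]) auto
  have subseq: "\<exists>r xs ps. strict_mono r \<and> ((x \<circ> (enumerate K \<circ> r)) \<longlonglongrightarrow> xs) \<and>
      (\<lambda>i. p (enumerate K (r i))) \<longlonglongrightarrow> ps" for K
  proof -
    have "bounded (range (\<lambda>i. (x (enumerate K i), p (enumerate K i))))"
      by (rule bounded_subset[OF bounded_pairs]) auto
    from bounded_imp_convergent_subsequence[OF this] obtain l r where
      r: "strict_mono r" and l: "((\<lambda>i. (x (enumerate K i), p (enumerate K i))) \<circ> r) \<longlonglongrightarrow> l"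
      by blast
    from r tendsto_fst[OF l] tendsto_snd[OF l] show ?thesis
      by (auto simp: o_def)
  qed
  \<comment> \<open>Such a limit point yields both claims: by continuity of \<open>JTF F\<close>,
    the gradients along \<open>r\<close> tend to 0 and fall below any
    \<open>\<epsilon>\<close>.\<close>
  have "\<exists>r xs. strict_mono r \<and> (x \<circ> r) \<longlonglongrightarrow> xs \<and> JTF F xs = 0"
    using assms(7)
  proof (elim disjE)
    assume "\<exists>k. N = enat k"
    then show ?thesis using infinity by simp
  next
    assume "\<exists>K1 \<subseteq> {k. enat k \<le> N}. infinite K1 \<and>
         (\<lambda>j. norm (F (x (enumerate K1 j)))) \<longlonglongrightarrow> 0"
    then obtain K where K: "infinite K" "(\<lambda>j. norm (F (x (enumerate K j)))) \<longlonglongrightarrow> 0"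
      by blast
    obtain r xs where r: "strict_mono r" and xl: "(x \<circ> (enumerate K \<circ> r)) \<longlonglongrightarrow> xs"
      using subseq[of K] by blast
    have "isCont F xs"
      using diff by (simp add: differentiable_imp_continuous_within)
    from isCont_tendsto_compose[OF this xl]
    have "(\<lambda>i. norm (F (x (enumerate K (r i))))) \<longlonglongrightarrow> norm (F xs)"
      by (simp add: tendsto_norm)
    moreover have "(\<lambda>i. norm (F (x (enumerate K (r i))))) \<longlonglongrightarrow> 0"
      using LIMSEQ_subseq_LIMSEQ[OF K(2) r] by (simp add: o_def)
    ultimately have "norm (F xs) = 0" using LIMSEQ_unique by blast
    then have "JTF F xs = 0" by (simp add: JTF_eq_0)
    with xl show ?thesis
      using strict_mono_o[OF strict_mono_enumerate[OF K(1)] r] by blast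
  next
    assume "\<exists>\<omega>>0. \<exists>K2 \<subseteq> {k. enat k < N}. infinite K2 \<and>
         (\<lambda>j. \<alpha> (enumerate K2 j)) \<longlonglongrightarrow> 0 \<and>
         (\<forall>k\<in>K2. \<bar>v k \<bullet> JTF F (x k)\<bar> \<ge> \<omega> * norm (v k) * norm (JTF F (x k)))"
    then obtain \<omega> K where \<omega>: "0 < \<omega>" and K: "infinite K" "(\<lambda>j. \<alpha> (enumerate K j)) \<longlonglongrightarrow> 0"
      and angle: "\<And>k. k \<in> K \<Longrightarrow> \<bar>v k \<bullet> JTF F (x k)\<bar> \<ge> \<omega> * norm (v k) * norm (JTF F (x k))"
      by blast
    obtain r xs ps where r: "strict_mono r" and xl: "(x \<circ> (enumerate K \<circ> r)) \<longlonglongrightarrow> xs"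
      and pl: "(\<lambda>i. p (enumerate K (r i))) \<longlonglongrightarrow> ps"
      using subseq[of K] by blast
    have "JTF F xs = 0"
    proof (rule stationary_if_angle_condition[OF diff cont par run xl _ _ \<omega>])
      show "(\<lambda>i. \<sigma> ((enumerate K \<circ> r) i) *\<^sub>R v ((enumerate K \<circ> r) i)) \<longlonglongrightarrow> ps"
        using pl by (simp add: p_def)
      show "(\<lambda>i. \<alpha> ((enumerate K \<circ> r) i)) \<longlonglongrightarrow> 0"
        using LIMSEQ_subseq_LIMSEQ[OF K(2) r] by (simp add: o_def)
    qed (use angle enumerate_in_set[OF K(1)] in simp)
    with xl show ?thesis
      using strict_mono_o[OF strict_mono_enumerate[OF K(1)] r] by blast
  qed
  then obtain r xs where r: "strict_mono r" and xl: "(x \<circ> r) \<longlonglongrightarrow> xs" and xs: "JTF F xs = 0"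
    by blast
  have "(\<lambda>i. norm (JTF F ((x \<circ> r) i))) \<longlonglongrightarrow> norm (JTF F xs)"
    using continuous_on_tendsto_compose[OF continuous_on_JTF[OF diff cont] xl]
    by (intro tendsto_norm) simp
  then have "(\<lambda>i. norm (JTF F (x (r i)))) \<longlonglongrightarrow> 0" by (simp add: xs)
  then have "\<exists>k. norm (JTF F (x k)) \<le> \<epsilon>" if "0 < \<epsilon>" for \<epsilon>
    using order_tendstoD(2)[OF _ that] eventually_happens'[OF sequentially_bot] less_imp_le by metis
  with infinity r xl xs show ?thesis
    unfolding seq_limit_point_def by auto
qed

end
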